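(* Let $p$ be an odd prime and let $G=\langle g\rangle$ be a cyclic group of order $p$. Fix $b\in\mathbb{F}_pG$, and let $\varphi_b:\mathbb{F}_pG\to\mathbb{F}_pG$ be the map $\varphi_b(c)=b\cdot\sigma(c)$. Then $$\ker(\varphi_b)=\operatorname{Span}_{\mathbb{F}_p}\left\{(g-1)^{p-j}\ :\ 0\le j\le k\right\}$$ for the unique $k\in\{0,\dots,p\}$ such that $b=(g-1)^k\,\tilde b$ for some $\tilde b=\sum_i\tilde b_ig^i\in\mathbb{F}_pG$ with $\sum_i\tilde b_i\neq0$.
   Context: $\sigma$ denotes the algebra automorphism of the group algebra $\mathbb{F}_pG$ determined by $g\mapsto g^{-1}$. In $\mathbb{F}_pG$ one has $(g-1)^p=0$. *)

theory Defs
  imports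
    "HOL-Library.Poly_Mapping"
    "HOL-Computational_Algebra.Group_Closure"
    "Berlekamp_Zassenhaus.Finite_Field"
begin

text \<open>
  The group algebra of a commutative group over the prime field with \<^term>\<open>CARD('p)\<close> elements.
  The group is a type \<open>'g\<close> written additively, and finitely supported functions on it carry
  the convolution product of \<^theory>\<open>HOL-Library.Poly_Mapping\<close>.
\<close>

type_synonym ('p, 'g) group_algebra = "('g, 'p mod_ring) poly_mapping"

definition basis_elem :: "'g \<Rightarrow> ('p::prime_card, 'g) group_algebra"
  where "basis_elem h = Poly_Mapping.single h 1"

definition scalar :: "'p::prime_card mod_ring \<Rightarrow> ('p, 'g) group_algebra \<Rightarrow> ('p, 'g) group_algebra"
  where "scalar a x = Poly_Mapping.map ((*) a) x"

lemma lookup_scalar [simp]: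
  "Poly_Mapping.lookup (scalar a x) h = a * Poly_Mapping.lookup x h"
  by (simp add: scalar_def Poly_Mapping.map.rep_eq when_def)

global_interpretation group_algebra: vector_space
  "scalar :: 'p::prime_card mod_ring \<Rightarrow> ('p, 'g) group_algebra \<Rightarrow> ('p, 'g) group_algebra"
  by unfold_locales (auto intro!: poly_mapping_eqI simp: lookup_add algebra_simps)

text \<open>
  The coefficient of \<open>sigma x\<close> at \<open>h\<close> is the coefficient of \<open>x\<close> at the inverse \<open>- h\<close>;
  the lemmas below show that this is the algebra automorphism inverting the basis elements.
\<close>

definition sigma :: "('p::prime_card, 'g::ab_group_add) group_algebra \<Rightarrow> ('p, 'g) group_algebra"
  where "sigma x = Poly_Mapping.map_key uminus x"

lemma lookup_sigma [simp]:
  "Poly_Mapping.lookup (sigma x) h = Poly_Mapping.lookup x (- h)"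
  by (simp add: sigma_def map_key.rep_eq)

lemma sigma_single: "sigma (Poly_Mapping.single h a) = Poly_Mapping.single (- h) a"
  by (rule poly_mapping_eqI) (auto simp: lookup_single when_def)

lemma sigma_basis_elem: "sigma (basis_elem h) = basis_elem (- h)"
  by (simp add: basis_elem_def sigma_single)

lemma sigma_one: "sigma 1 = 1"
  by (metis sigma_single single_one neg_equal_0_iff_equal)

lemma sigma_zero: "sigma 0 = 0"
  by (rule poly_mapping_eqI) simp

lemma sigma_add: "sigma (x + y) = sigma x + sigma y"
  by (rule poly_mapping_eqI) (simp add: lookup_add)

lemma sigma_scalar: "sigma (scalar a x) = scalar a (sigma x)"
  by (rule poly_mapping_eqI) simp

lemma poly_mapping_single_add_induct [case_names zero add]:
  fixes P :: "('a, 'b::comm_monoid_add) poly_mapping \<Rightarrow> bool"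
  assumes "P 0" and "\<And>h a x. P x \<Longrightarrow> P (Poly_Mapping.single h a + x)"
  shows "P x"
proof (induction x rule: Poly_Mapping.update_induct)
  case const
  show ?case by (fact assms(1))
next
  case (update x h a)
  have "Poly_Mapping.update h a x = Poly_Mapping.single h a + x"
    using update(1)
    by (intro poly_mapping_eqI) (auto simp: lookup_add lookup_single update.rep_eq in_keys_iff when_def)
  then show ?case using assms(2) update by simp
qed

lemma sigma_mult: "sigma (x * y) = sigma x * sigma y"
proof -
  have single: "sigma (Poly_Mapping.single h a * y) = sigma (Poly_Mapping.single h a) * sigma y" for h a
    by (induction y rule: poly_mapping_single_add_induct)
       (simp_all add: mult_single sigma_single distrib_left sigma_add sigma_zero add.commute)
  show ?thesis
    by (induction x rule: poly_mapping_single_add_induct)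
       (simp_all add: single distrib_right sigma_add sigma_zero)
qed

lemma bij_sigma: "bij sigma"
  by (rule o_bij[where g = sigma]) (auto intro!: poly_mapping_eqI simp: fun_eq_iff)

definition phi :: "('p::prime_card, 'g::ab_group_add) group_algebra \<Rightarrow>
    ('p, 'g) group_algebra \<Rightarrow> ('p, 'g) group_algebra"
  where "phi b c = b * sigma c"

text \<open>
  \<open>factors_at g b k\<close>: \<open>b\<close> is the product of the \<open>k\<close>-th power of \<open>g - 1\<close> with some
  \<open>\<Sum>\<^sub>i \<beta>\<^sub>i g\<^sup>i\<close> such that \<open>\<Sum>\<^sub>i \<beta>\<^sub>i \<noteq> 0\<close>.
\<close>

definition factors_at ::
    "'g::ab_group_add \<Rightarrow> ('p::prime_card, 'g) group_algebra \<Rightarrow> nat \<Rightarrow> bool"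
  where "factors_at g b k \<longleftrightarrow>
    (\<exists>\<beta> :: nat \<Rightarrow> 'p mod_ring.
       b = (basis_elem g - 1) ^ k * (\<Sum>i<CARD('p). scalar (\<beta> i) (basis_elem g ^ i)) \<and>
       (\<Sum>i<CARD('p). \<beta> i) \<noteq> 0)"

end

theory Submission
  imports Defs
begin

text \<open>
  Put \<open>t = g - 1\<close>. The Frobenius map is additive in characteristic \<open>p\<close>, so
  \<open>t\<^sup>p = g\<^sup>p - 1 = 0\<close>, whereas no lower power of \<open>t\<close> vanishes because its expansion in the
  powers of \<open>g\<close> has a nonzero constant coefficient. The group algebra is therefore a truncated
  polynomial ring in \<open>t\<close>, and \<open>t\<close> generates its maximal ideal: modulo \<open>t\<close>, an element
  \<open>\<Sum>\<^sub>i \<beta>\<^sub>i g\<^sup>i\<close> equals the scalar \<open>\<Sum>\<^sub>i \<beta>\<^sub>i\<close>, its augmentation. An element whose augmentation is not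
  zero is a unit, since its \<open>p\<close>-th power is a nonzero scalar (\<open>unit_if_augmentation_nonzero\<close>);
  an element whose augmentation is zero is divisible by \<open>t\<close>. Hence every \<open>b\<close> is \<open>t\<^sup>k\<close> times a unit
  (\<open>ex_factors_at\<close>), and \<open>k \<le> p\<close> is unique because it is determined by which
  \<open>t\<^sup>n\<close> annihilate \<open>b\<close> (\<open>factors_at_unique\<close>).

  Cancelling the unit, \<open>b \<sigma>(c) = 0\<close> means \<open>t\<^sup>k \<sigma>(c) = 0\<close>. Writing \<open>\<sigma>(c)\<close> itself as a power of \<open>t\<close>
  times a unit shows that this is the case exactly when \<open>t\<close> to the power \<open>p - k\<close> divides \<open>\<sigma>(c)\<close>
  (\<open>t_power_mult_eq_0_iff\<close>). The ideals generated by powers of \<open>t\<close> are stable under \<open>\<sigma>\<close>, because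
  \<open>\<sigma>(t)\<close> is the product of \<open>t\<close> and \<open>- g\<close> inverse (\<open>t_power_dvd_sigma_iff\<close>), so \<open>\<sigma>\<close> may be dropped. The
  ideal that remains is spanned by the powers of \<open>t\<close> with exponents from \<open>p - k\<close> to \<open>p\<close>
  (\<open>t_power_ideal_eq_span\<close>).
\<close>

section \<open>Cyclic groups of finite order\<close>

abbreviation multiple :: "nat \<Rightarrow> 'g::ab_group_add \<Rightarrow> 'g"
  where "multiple n g \<equiv> (\<Sum>_<n. g)"

lemma multiple_add: "multiple (m + n) g = multiple m g + multiple n (g::'g::ab_group_add)"
  by (induction n) (simp_all add: add_ac)

text \<open>
  Translation by \<open>g\<close> permutes the group, so it does not change the sum of all elements; yet it
  adds \<open>g\<close> to that sum once for every element.
\<close>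
lemma multiple_card_eq_0:
  fixes g :: "'g::ab_group_add"
  assumes "finite (UNIV :: 'g set)"
  shows "multiple CARD('g) g = 0"
proof -
  have sum_const: "(\<Sum>h\<in>A. g) = multiple (card A) g" if "finite A" for A :: "'g set"
    using that by induction (simp_all add: add.commute)
  have "(\<Sum>h\<in>(UNIV::'g set). h) = (\<Sum>h\<in>UNIV. h + g)"
    by (rule sum.reindex_bij_betw[symmetric, of "\<lambda>h. h + g" _ _ "\<lambda>h. h"])
       (rule bij_betwI[of _ _ _ "\<lambda>h. h - g"]; simp)
  also have "\<dots> = (\<Sum>h\<in>(UNIV::'g set). h) + multiple CARD('g) g"
    using assms by (simp add: sum.distrib sum_const)
  finally show ?thesis by simp
qed

text \<open>
  The multiples of \<open>g\<close> are closed under subtraction because they are periodic, so they exhaust the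
  closure; injectivity then follows by counting.
\<close>
lemma bij_betw_multiples_generator:
  fixes g :: "'g::ab_group_add"
  assumes "finite (UNIV :: 'g set)" and "group_closure {g} = (UNIV :: 'g set)"
  shows "bij_betw (\<lambda>i. multiple i g) {..<CARD('g)} UNIV"
proof -
  let ?n = "CARD('g)"
  have n: "?n > 0" using assms(1) by (simp add: card_gt_0_iff)
  have periodic: "multiple (i + k * ?n) g = multiple i g" for i k
  proof (induction k)
    case (Suc k)
    have "i + Suc k * ?n = (i + k * ?n) + ?n" by simp
    then show ?case
      using Suc by (simp only: multiple_add[where n = ?n] multiple_card_eq_0[OF assms(1)] add_0_right)
  qed simp
  have reduce: "multiple i g \<in> (\<lambda>i. multiple i g) ` {..<?n}" for i
    using periodic[of "i mod ?n" "i div ?n"] n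
    by (metis imageI lessThan_iff mod_div_mult_eq mod_less_divisor)
  have "h \<in> range (\<lambda>i. multiple i g)" if "h \<in> group_closure {g}" for h
    using that
  proof induction
    case (base s)
    then have "s = multiple 0 g \<or> s = multiple 1 g" by auto
    then show ?case by blast
  next
    case (diff s t)
    then obtain i j where ij: "s = multiple i g" "t = multiple j g" by blast
    \<comment> \<open>Modulo the period \<open>n\<close>, the number \<open>j * (n - 1)\<close> represents \<open>- j\<close>.\<close>
    have "i + j * (?n - 1) + j = i + j * ?n"
      using n by (cases ?n) simp_all
    then have "multiple (i + j * (?n - 1)) g + multiple j g = multiple (i + j * ?n) g"
      by (simp only: multiple_add[symmetric])
    then have "s - t = multiple (i + j * (?n - 1)) g"
      using periodic[of i j] ij by (metis add_diff_cancel)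
    then show ?case by blast
  qed
  then have surj: "(\<lambda>i. multiple i g) ` {..<?n} = UNIV"
    using assms(2) reduce by blast
  then have "inj_on (\<lambda>i. multiple i g) {..<?n}"
    by (intro eq_card_imp_inj_on) auto
  with surj show ?thesis by (simp add: bij_betw_def)
qed

section \<open>Group algebras over a prime field\<close>

lemma scalar_eq_mult: "scalar a x = Poly_Mapping.single (0::'g::ab_group_add) a * x"
proof (induction x rule: poly_mapping_single_add_induct)
  case zero
  show ?case by (simp add: group_algebra.scale_zero_right)
next
  case (add h c x)
  have "scalar a (Poly_Mapping.single h c) = Poly_Mapping.single 0 a * Poly_Mapping.single h c"
    by (rule poly_mapping_eqI) (simp add: mult_single lookup_single when_def)
  with add show ?case by (simp add: group_algebra.scale_right_distrib distrib_left)
qed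

lemma scalar_mult_right:
  "scalar a (x * y) = x * scalar a (y :: ('p::prime_card, 'g::ab_group_add) group_algebra)"
  by (simp add: scalar_eq_mult mult_ac)

text \<open>
  The multiples of the unit are supported at the neutral element, so the characteristic is that
  of the coefficient field.
\<close>
lemma CHAR_group_algebra:
  "CHAR(('p::prime_card, 'g::ab_group_add) group_algebra) = CARD('p)"
proof (rule CHAR_eqI)
  show "of_nat CARD('p) = (0 :: ('p, 'g) group_algebra)"
    by (rule poly_mapping_eqI) (simp add: lookup_of_nat)
next
  fix n assume "of_nat n = (0 :: ('p, 'g) group_algebra)"
  then have "Poly_Mapping.lookup (of_nat n :: ('p, 'g) group_algebra) 0 = 0" by simp
  then have "of_nat n = (0 :: 'p mod_ring)" by (simp add: lookup_of_nat)
  then show "CARD('p) dvd n" by (rule of_nat_0_mod_ring_dvd)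
qed

lemma frobenius_add:
  fixes x y :: "('p::prime_card, 'g::ab_group_add) group_algebra"
  shows "(x + y) ^ CARD('p) = x ^ CARD('p) + y ^ CARD('p)"
  by (rule freshmans_dream) (simp_all add: CHAR_group_algebra prime_card)

lemma basis_elem_add:
  "basis_elem (h + k) = basis_elem h * (basis_elem k :: ('p::prime_card, 'g::ab_group_add) group_algebra)"
  by (simp add: basis_elem_def mult_single)

lemma basis_elem_0: "basis_elem (0::'g::ab_group_add) = 1"
  by (simp add: basis_elem_def)

lemma basis_elem_power: "basis_elem g ^ n = basis_elem (multiple n (g::'g::ab_group_add))"
  by (induction n) (simp_all add: basis_elem_0 basis_elem_add mult.commute)

lemma lookup_basis_elem_power:
  "Poly_Mapping.lookup (basis_elem g ^ n) h = (if multiple n (g::'g::ab_group_add) = h then 1 else 0)"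
  unfolding basis_elem_power by (simp add: basis_elem_def lookup_single when_def)

lemma sigma_diff: "sigma (x - y) = sigma x - sigma y"
  by (rule poly_mapping_eqI) (simp add: lookup_minus)

lemma sigma_power: "sigma (x ^ n) = sigma x ^ n"
  by (induction n) (simp_all add: sigma_one sigma_mult)

lemma sigma_sigma: "sigma (sigma x) = x"
  by (rule poly_mapping_eqI) simp

section \<open>The group algebra as a truncated polynomial ring\<close>

text \<open>
  The parameter \<open>t\<close> abbreviates \<open>g - 1\<close>; it also fixes the coefficient field, which the group
  element \<open>g\<close> alone does not determine.
\<close>
locale modular_cyclic_group_algebra =
  fixes g :: "'g::ab_group_add" and t :: "('p::prime_card, 'g) group_algebra"
  assumes t_def: "t = basis_elem g - 1"
    and card_group: "CARD('g) = CARD('p)"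
    and generator: "group_closure {g} = (UNIV :: 'g set)"
begin

lemma finite_group: "finite (UNIV :: 'g set)"
  by (rule card_ge_0_finite) (simp add: card_group)

lemma bij_multiples: "bij_betw (\<lambda>i. multiple i g) {..<CARD('p)} UNIV"
  using bij_betw_multiples_generator[OF finite_group generator] card_group by simp

lemma multiple_eq_iff:
  assumes "i < CARD('p)" and "j < CARD('p)"
  shows "multiple i g = multiple j g \<longleftrightarrow> i = j"
  using inj_on_eq_iff[OF bij_betw_imp_inj_on[OF bij_multiples], of i j] assms by simp

lemma basis_elem_g_eq: "basis_elem g = t + 1"
  by (simp add: t_def)

lemma expansion_in_powers_of_g:
  fixes x :: "('p, 'g) group_algebra"
  shows "x = (\<Sum>i<CARD('p). scalar (Poly_Mapping.lookup x (multiple i g)) (basis_elem g ^ i))"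
proof (rule poly_mapping_eqI)
  fix h
  obtain j where j: "j < CARD('p)" "h = multiple j g"
    using bij_betw_imp_surj_on[OF bij_multiples] by blast
  have "Poly_Mapping.lookup (\<Sum>i<CARD('p). scalar (Poly_Mapping.lookup x (multiple i g)) (basis_elem g ^ i)) h
      = (\<Sum>i<CARD('p). if i = j then Poly_Mapping.lookup x h else 0)"
    unfolding lookup_sum
  proof (rule sum.cong)
    fix i assume "i \<in> {..<CARD('p)}"
    then have "multiple i g = h \<longleftrightarrow> i = j"
      using j by (simp add: multiple_eq_iff)
    then show "Poly_Mapping.lookup (scalar (Poly_Mapping.lookup x (multiple i g)) (basis_elem g ^ i)) h
        = (if i = j then Poly_Mapping.lookup x h else 0)"
      using j by (auto simp: lookup_basis_elem_power)
  qed simp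
  then show "Poly_Mapping.lookup x h = Poly_Mapping.lookup
      (\<Sum>i<CARD('p). scalar (Poly_Mapping.lookup x (multiple i g)) (basis_elem g ^ i)) h"
    using j by simp
qed

text \<open>
  The additivity of the Frobenius map gives \<open>g\<^sup>p = (t + 1)\<^sup>p = t\<^sup>p + 1\<close>, and \<open>g\<^sup>p = 1\<close>.
\<close>
lemma t_power_card: "t ^ CARD('p) = 0"
proof -
  have "basis_elem g ^ CARD('p) = (t + 1) ^ CARD('p)" by (simp add: basis_elem_g_eq)
  then have "basis_elem g ^ CARD('p) = t ^ CARD('p) + 1" by (simp add: frobenius_add)
  moreover have "basis_elem g ^ CARD('p) = (1 :: ('p, 'g) group_algebra)"
    using multiple_card_eq_0[OF finite_group, of g]
    by (simp add: basis_elem_power card_group basis_elem_0)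
  ultimately show ?thesis by simp
qed

text \<open>
  For \<open>n < p\<close> the powers \<open>g\<^sup>0, \<dots>, g\<^sup>n\<close> are distinct basis elements, so the binomial
  expansion of \<open>(g - 1)\<^sup>n\<close> has the coefficient \<open>(- 1)\<^sup>n\<close> at the neutral element.
\<close>
lemma t_power_eq_0_iff: "t ^ n = 0 \<longleftrightarrow> CARD('p) \<le> n"
proof
  assume "CARD('p) \<le> n"
  then show "t ^ n = 0" using t_power_card by (metis dvd_0_left le_imp_power_dvd)
next
  assume t0: "t ^ n = 0"
  show "CARD('p) \<le> n"
  proof (rule ccontr)
    assume n: "\<not> CARD('p) \<le> n"
    have lookup0: "Poly_Mapping.lookup (scalar c (basis_elem g ^ i)) 0 = (if i = 0 then c else 0)"
      if "i \<le> n" for i and c :: "'p mod_ring"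
    proof -
      have "multiple i g = multiple 0 g \<longleftrightarrow> i = 0"
        using n that by (intro multiple_eq_iff) simp_all
      then show ?thesis by (simp add: lookup_basis_elem_power)
    qed
    have "t ^ n = (\<Sum>i\<le>n. of_nat (n choose i) * basis_elem g ^ i * (- 1) ^ (n - i))"
      unfolding t_def using binomial_ring[of "basis_elem g" "-1" n] by simp
    also have "\<dots> = (\<Sum>i\<le>n. scalar (of_nat (n choose i) * (- 1) ^ (n - i)) (basis_elem g ^ i))"
    proof (rule sum.cong)
      have minus1: "(- 1 :: ('p, 'g) group_algebra) ^ k = Poly_Mapping.single 0 ((- 1) ^ k)" for k
        by (cases "even k") (simp_all add: single_uminus)
      have coeff: "Poly_Mapping.single 0 (of_nat m * a) = of_nat m * Poly_Mapping.single (0::'g) a"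
        for m and a :: "'p mod_ring"
        using mult_single[of "0::'g" "of_nat m" 0 a] by simp
      fix i
      show "of_nat (n choose i) * basis_elem g ^ i * (- 1) ^ (n - i) =
          (scalar (of_nat (n choose i) * (- 1) ^ (n - i)) (basis_elem g ^ i) :: ('p, 'g) group_algebra)"
        unfolding scalar_eq_mult coeff minus1[symmetric] by (simp only: mult_ac)
    qed simp
    finally have "Poly_Mapping.lookup (t ^ n) 0 = (\<Sum>i\<le>n. Poly_Mapping.lookup
        (scalar (of_nat (n choose i) * (- 1) ^ (n - i)) (basis_elem g ^ i) :: ('p, 'g) group_algebra) 0)"
      by (simp only: lookup_sum)
    also have "\<dots> = (\<Sum>i\<le>n. if i = 0 then (- 1) ^ n else (0 :: 'p mod_ring))"
      by (rule sum.cong[OF refl]) (subst lookup0; simp)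
    finally show False using t0 by simp
  qed
qed

text \<open>
  Modulo \<open>t = g - 1\<close> every power of \<open>g\<close> becomes \<open>1\<close>. The single term at \<open>0\<close> embeds the
  scalar \<open>\<Sum>\<^sub>i \<beta>\<^sub>i\<close> into the algebra.
\<close>
lemma t_dvd_minus_augmentation:
  "t dvd (\<Sum>i<n. scalar (\<beta> i) (basis_elem g ^ i)) - Poly_Mapping.single 0 (\<Sum>i<n. \<beta> i)"
proof (induction n)
  case (Suc n)
  have "t dvd basis_elem g ^ n - 1"
    using power_diff_1_eq[of "basis_elem g :: ('p, 'g) group_algebra" n] by (simp add: t_def)
  then have "t dvd scalar (\<beta> n) (basis_elem g ^ n) - Poly_Mapping.single 0 (\<beta> n)"
    unfolding scalar_eq_mult by (metis dvd_mult mult.right_neutral right_diff_distrib)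
  from dvd_add[OF Suc this] show ?case
    by (simp add: single_add algebra_simps)
qed simp

text \<open>
  Write \<open>u = t w + s\<close> with the scalar \<open>s = \<Sum>\<^sub>i \<beta>\<^sub>i\<close>. Raising this to the power \<open>p\<close> kills \<open>t w\<close>, so
  \<open>u\<^sup>p = s\<^sup>p\<close> is a unit, and \<open>u\<close> divides it.
\<close>
lemma unit_if_augmentation_nonzero:
  assumes "(\<Sum>i<n. \<beta> i) \<noteq> 0"
  shows "(\<Sum>i<n. scalar (\<beta> i) (basis_elem g ^ i) :: ('p, 'g) group_algebra) dvd 1"
proof -
  define u :: "('p, 'g) group_algebra" where "u = (\<Sum>i<n. scalar (\<beta> i) (basis_elem g ^ i))"
  define s where "s = (\<Sum>i<n. \<beta> i)"
  obtain w where w: "u - Poly_Mapping.single 0 s = t * w"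
    using t_dvd_minus_augmentation[where \<beta> = \<beta> and n = n] unfolding u_def s_def by (elim dvdE)
  have "u ^ CARD('p) = (t * w + Poly_Mapping.single 0 s) ^ CARD('p)"
    by (simp flip: w)
  also have "\<dots> = Poly_Mapping.single 0 s ^ CARD('p)"
    by (simp add: frobenius_add power_mult_distrib t_power_card)
  finally have u_pow: "u ^ CARD('p) = Poly_Mapping.single 0 s ^ CARD('p)" .
  have "Poly_Mapping.single 0 s * Poly_Mapping.single 0 (inverse s) = (1 :: ('p, 'g) group_algebra)"
    using assms by (simp add: mult_single s_def)
  then have "Poly_Mapping.single 0 s dvd (1 :: ('p, 'g) group_algebra)"
    by (metis dvd_triv_left)
  then have "u ^ CARD('p) dvd 1"
    unfolding u_pow by (metis dvd_power_same power_one)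
  then show ?thesis
    unfolding u_def[symmetric] by (metis dvd_power dvd_trans zero_less_card_finite)
qed

lemma factors_at_imp_unit:
  assumes "factors_at g b k"
  obtains u v where "b = t ^ k * u" and "u * v = 1"
proof -
  obtain \<beta> :: "nat \<Rightarrow> 'p mod_ring"
    where "b = t ^ k * (\<Sum>i<CARD('p). scalar (\<beta> i) (basis_elem g ^ i))"
      and "(\<Sum>i<CARD('p). \<beta> i) \<noteq> 0"
    using assms unfolding factors_at_def t_def by blast
  moreover from this(2) obtain v where
    "1 = (\<Sum>i<CARD('p). scalar (\<beta> i) (basis_elem g ^ i)) * (v :: ('p, 'g) group_algebra)"
    using unit_if_augmentation_nonzero unfolding dvd_def by blast
  ultimately show thesis using that by simp
qed

text \<open>
  Take the largest \<open>k \<le> p\<close> such that \<open>t\<^sup>k\<close> divides \<open>b\<close>. If \<open>k < p\<close>, then the cofactor has nonzero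
  augmentation, as otherwise \<open>t\<close> would divide it and \<open>k\<close> would not be maximal.
\<close>
lemma ex_factors_at:
  obtains k where "k \<le> CARD('p)" and "factors_at g (b :: ('p, 'g) group_algebra) k"
proof -
  let ?S = "{k. k \<le> CARD('p) \<and> t ^ k dvd b}"
  define k where "k = Max ?S"
  have fin: "finite ?S" by simp
  moreover have "0 \<in> ?S" by simp
  ultimately have "Max ?S \<in> ?S" by (intro Max_in) blast+
  then have k: "k \<in> ?S" unfolding k_def .
  then obtain a where a: "b = t ^ k * a" unfolding dvd_def by blast
  show thesis
  proof (cases "k = CARD('p)")
    case True
    \<comment> \<open>Then \<open>b = 0\<close>, and \<open>1\<close> serves as the cofactor.\<close>
    let ?\<beta> = "\<lambda>i. if i = 0 then 1 else 0 :: 'p mod_ring"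
    have "b = (basis_elem g - 1) ^ k * (\<Sum>i<CARD('p). scalar (?\<beta> i) (basis_elem g ^ i))"
      using a True t_power_card by (simp flip: t_def)
    moreover have "(\<Sum>i<CARD('p). ?\<beta> i) \<noteq> 0" by simp
    ultimately have "factors_at g b k"
      unfolding factors_at_def by (intro exI[of _ ?\<beta>] conjI)
    with True that[of k] show thesis by simp
  next
    case False
    define \<beta> where "\<beta> i = Poly_Mapping.lookup a (multiple i g)" for i
    have a_eq: "a = (\<Sum>i<CARD('p). scalar (\<beta> i) (basis_elem g ^ i))"
      unfolding \<beta>_def by (rule expansion_in_powers_of_g)
    have "(\<Sum>i<CARD('p). \<beta> i) \<noteq> 0"
    proof
      assume "(\<Sum>i<CARD('p). \<beta> i) = 0"
      then have "t dvd a"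
        using t_dvd_minus_augmentation[where \<beta> = \<beta> and n = "CARD('p)"] by (simp flip: a_eq)
      then have "t ^ Suc k dvd b"
        unfolding a by (simp add: mult.commute[of t] mult_dvd_mono)
      then have "Suc k \<in> ?S" using k False by simp
      then have "Suc k \<le> k" unfolding k_def by (rule Max_ge[OF fin])
      then show False by simp
    qed
    then have "factors_at g b k"
      using a a_eq unfolding factors_at_def t_def by blast
    with k that[of k] show thesis by simp
  qed
qed

text \<open>
  With \<open>x = t\<^sup>m u\<close> for a unit \<open>u\<close>, the left-hand side says that \<open>t\<close> to the power \<open>k + m\<close> vanishes,
  that is \<open>p \<le> k + m\<close>.
\<close>
lemma t_power_mult_eq_0_iff:
  assumes "k \<le> CARD('p)"
  shows "t ^ k * x = 0 \<longleftrightarrow> t ^ (CARD('p) - k) dvd x"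
proof
  assume x0: "t ^ k * x = 0"
  obtain m where m: "factors_at g x m" by (rule ex_factors_at)
  then obtain u v where u: "x = t ^ m * u" "u * v = 1"
    by (rule factors_at_imp_unit)
  have "t ^ (k + m) = t ^ k * x * v"
    using u by (simp add: power_add mult.assoc)
  then have "CARD('p) - k \<le> m" using x0 t_power_eq_0_iff[of "k + m"] by simp
  then show "t ^ (CARD('p) - k) dvd x" unfolding u(1) by (simp add: le_imp_power_dvd)
next
  assume "t ^ (CARD('p) - k) dvd x"
  then obtain y where "x = t ^ (CARD('p) - k) * y" by (elim dvdE)
  then show "t ^ k * x = 0"
    using assms t_power_card by (simp flip: mult.assoc power_add)
qed

text \<open>
  The powers of \<open>t\<close> annihilating \<open>b\<close> are those with exponent at least \<open>p - k\<close>, so \<open>b\<close>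
  determines \<open>k\<close> as long as \<open>k \<le> p\<close>.
\<close>
lemma factors_at_unique:
  fixes b :: "('p, 'g) group_algebra"
  assumes "factors_at g b k" and "factors_at g b l" and "k \<le> CARD('p)" and "l \<le> CARD('p)"
  shows "k = l"
proof -
  have exact: "t ^ n * b = 0 \<longleftrightarrow> CARD('p) \<le> n + m" if b: "factors_at g b m" for m n
  proof -
    obtain u v where u: "b = t ^ m * u" "u * v = 1"
      using b by (rule factors_at_imp_unit)
    have "t ^ n * b = t ^ (n + m) * u" by (simp add: u power_add mult.assoc)
    moreover have "t ^ (n + m) = t ^ (n + m) * u * v" by (simp add: u mult.assoc)
    ultimately show ?thesis using t_power_eq_0_iff[of "n + m"] by (metis mult_zero_left)
  qed
  from exact[OF assms(1)] exact[OF assms(2)]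
  have "CARD('p) \<le> n + k \<longleftrightarrow> CARD('p) \<le> n + l" for n by simp
  from this[of "CARD('p) - k"] this[of "CARD('p) - l"] assms(3,4) show ?thesis by simp
qed

section \<open>Kernels and ideals\<close>

text \<open>
  The inverse of \<open>g\<close> minus \<open>1\<close> is a multiple of \<open>g - 1\<close>, so \<open>\<sigma>\<close> maps the ideal generated by
  \<open>t\<^sup>m\<close> into itself; being an involution, it also reflects membership.
\<close>
lemma t_power_dvd_sigma_iff: "t ^ m dvd sigma c \<longleftrightarrow> t ^ m dvd c"
proof -
  have "t * basis_elem (- g) + sigma t = basis_elem (g + - g) - 1"
    unfolding basis_elem_add
    by (simp add: t_def sigma_diff sigma_basis_elem sigma_one left_diff_distrib)
  then have "t * (- basis_elem (- g)) = sigma t"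
    by (simp add: basis_elem_0 add_eq_0_iff2)
  then have "t dvd sigma t" by (metis dvd_triv_left)
  then have "t ^ m dvd sigma (t ^ m)" unfolding sigma_power by (rule dvd_power_same)
  then have dvd_sigma: "t ^ m dvd sigma x" if "t ^ m dvd x" for x
    using that by (metis dvd_def dvd_mult2 sigma_mult)
  from dvd_sigma[of c] dvd_sigma[of "sigma c"] show ?thesis
    by (auto simp: sigma_sigma)
qed

text \<open>
  The powers of \<open>g\<close> span the algebra, and \<open>g\<^sup>i = (t + 1)\<^sup>i\<close> is a combination of powers of \<open>t\<close> by the
  binomial theorem.
\<close>
lemma span_t_powers: "group_algebra.span (range ((^) t)) = UNIV"
proof -
  have "x \<in> group_algebra.span (range ((^) t))" for x
  proof -
    have "basis_elem g ^ i \<in> group_algebra.span (range ((^) t))" for i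
    proof -
      have "basis_elem g ^ i = (\<Sum>j\<le>i. scalar (of_nat (i choose j)) (t ^ j))"
        unfolding basis_elem_g_eq binomial_ring scalar_eq_mult single_of_nat by simp
      also have "\<dots> \<in> group_algebra.span (range ((^) t))"
        by (intro group_algebra.span_sum group_algebra.span_scale group_algebra.span_base) simp
      finally show ?thesis .
    qed
    then show ?thesis
      by (subst expansion_in_powers_of_g)
         (auto intro!: group_algebra.span_sum group_algebra.span_scale)
  qed
  then show ?thesis by blast
qed

text \<open>
  The ideal is spanned by the products of its generator with the powers \<open>t\<^sup>i\<close>. The exponent
  \<open>p - k + i\<close> has the form \<open>p - j\<close> with \<open>j = k - i\<close> when \<open>i \<le> k\<close>, and the product vanishes otherwise.
\<close>
lemma t_power_ideal_eq_span:
  assumes "k \<le> CARD('p)"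
  shows "{c. t ^ (CARD('p) - k) dvd c} = group_algebra.span {t ^ (CARD('p) - j) | j. 0 \<le> j \<and> j \<le> k}"
    (is "?I = group_algebra.span ?B")
proof
  let ?m = "CARD('p) - k"
  have "t ^ ?m * x \<in> group_algebra.span ?B" for x
  proof -
    have "x \<in> group_algebra.span (range ((^) t))" by (simp add: span_t_powers)
    then show ?thesis
    proof (induction rule: group_algebra.span_induct_alt)
      case base
      show ?case by (simp add: group_algebra.span_zero)
    next
      case (step c y x)
      then obtain i where y: "y = t ^ i" by blast
      have "t ^ (?m + i) \<in> group_algebra.span ?B"
      proof (cases "?m + i \<le> CARD('p)")
        case True
        then have "t ^ (?m + i) = t ^ (CARD('p) - (k - i))" using assms by simp
        moreover have "t ^ (CARD('p) - (k - i)) \<in> ?B" by (rule CollectI) (intro exI[of _ "k - i"]; simp)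
        ultimately show ?thesis by (simp only: group_algebra.span_base)
      next
        case False
        then have "t ^ (?m + i) = 0" by (simp add: t_power_eq_0_iff)
        then show ?thesis by (simp only: group_algebra.span_zero)
      qed
      then have "scalar c (t ^ (?m + i)) + t ^ ?m * x \<in> group_algebra.span ?B"
        using step.IH by (intro group_algebra.span_add group_algebra.span_scale)
      moreover have "t ^ ?m * (scalar c y + x) = scalar c (t ^ (?m + i)) + t ^ ?m * x"
        by (simp only: distrib_left y power_add scalar_mult_right)
      ultimately show ?case by (simp only:)
    qed
  qed
  then show "?I \<subseteq> group_algebra.span ?B" by (auto simp only: dvd_def)
next
  have "?B \<subseteq> ?I" by (auto intro!: le_imp_power_dvd)
  moreover have "group_algebra.subspace ?I"
    by (rule group_algebra.subspaceI) (auto simp: scalar_eq_mult)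
  ultimately show "group_algebra.span ?B \<subseteq> ?I" by (rule group_algebra.span_minimal)
qed

lemma kernel_phi_eq_span:
  assumes "k \<le> CARD('p)" and "factors_at g b k"
  shows "{c. phi b c = 0} = group_algebra.span {t ^ (CARD('p) - j) | j. 0 \<le> j \<and> j \<le> k}"
proof -
  obtain u v where u: "b = t ^ k * u" "u * v = 1"
    using assms(2) by (rule factors_at_imp_unit)
  have "phi b c = 0 \<longleftrightarrow> t ^ (CARD('p) - k) dvd c" for c
  proof -
    have "phi b c = u * (t ^ k * sigma c)" by (simp add: phi_def u(1) mult_ac)
    moreover have "v * (u * (t ^ k * sigma c)) = t ^ k * sigma c"
      using u(2) by (simp add: mult.commute[of v u] flip: mult.assoc)
    ultimately have "phi b c = 0 \<longleftrightarrow> t ^ k * sigma c = 0" by (metis mult_zero_right)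
    then show ?thesis
      by (simp add: t_power_mult_eq_0_iff[OF assms(1)] t_power_dvd_sigma_iff)
  qed
  then show ?thesis by (simp only: t_power_ideal_eq_span[OF assms(1)])
qed

end

theorem proposition7p4:
  fixes p :: nat
    and g :: "'g::ab_group_add"
    and b :: "('p::prime_card, 'g) group_algebra"
  assumes "prime p" and "odd p"
    and "CARD('p) = p"
    and "CARD('g) = p" and "group_closure {g} = (UNIV :: 'g set)"
  shows "(\<exists>!k. k \<in> {0..p} \<and> factors_at g b k) \<and>
    (\<forall>k\<in>{0..p}. factors_at g b k \<longrightarrow>
      {c. phi b c = 0} = group_algebra.span {(basis_elem g - 1) ^ (p - j) | j. 0 \<le> j \<and> j \<le> k})"
proof -
  interpret modular_cyclic_group_algebra g "basis_elem g - 1 :: ('p, 'g) group_algebra"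
    using assms by unfold_locales simp_all
  obtain k where "k \<le> CARD('p)" and "factors_at g b k" by (rule ex_factors_at)
  then have "\<exists>!k. k \<in> {0..p} \<and> factors_at g b k"
    using factors_at_unique[of b] by (intro ex1I[of _ k]) (simp_all add: assms(3))
  moreover have "\<forall>k\<in>{0..p}. factors_at g b k \<longrightarrow>
      {c. phi b c = 0} = group_algebra.span {(basis_elem g - 1) ^ (p - j) | j. 0 \<le> j \<and> j \<le> k}"
  proof (intro ballI impI)
    fix k assume "k \<in> {0..p}" and b: "factors_at g b k"
    then have "k \<le> CARD('p)" using assms(3) by simp
    from kernel_phi_eq_span[OF this b]
    show "{c. phi b c = 0} = group_algebra.span {(basis_elem g - 1) ^ (p - j) | j. 0 \<le> j \<and> j \<le> k}"
      unfolding assms(3) .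
  qed
  ultimately show ?thesis ..
qed

end
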